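(* Let $H$ be a word hyperbolic group and let $Q$ be an infinite quasi-normal subgroup of $H$. Then the limit set of $Q$ in the (Gromov) boundary $\partial H$ is all of $\partial H$.
   Context: For a subgroup $Q$ of a group $H$, the commensurator of $Q$ in $H$ is $Comm(Q,H)=\{h\in H : hQh^{-1}\cap Q \text{ has finite index in both } Q \text{ and } hQh^{-1}\}$. The subgroup $Q$ is quasi-normal in $H$ if $Comm(Q,H)=H$. The limit set of $Q$ is the set of accumulation points in $\partial H$ of $Q$, regarded as a set of vertices of a Cayley graph of $H$ with respect to a finite generating set. *)

theory Defs
  imports "HOL-Analysis.Analysis" "HOL-Algebra.Generated_Groups"
begin

section \<open>Commensurators\<close>

definition finite_index_in :: "('a, 'b) monoid_scheme \<Rightarrow> 'a set \<Rightarrow> 'a set \<Rightarrow> bool" where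
  "finite_index_in G K L \<longleftrightarrow> subgroup K (G\<lparr>carrier := L\<rparr>) \<and> finite (rcosets\<^bsub>G\<lparr>carrier := L\<rparr>\<^esub> K)"

definition conjugate_subgroup :: "('a, 'b) monoid_scheme \<Rightarrow> 'a \<Rightarrow> 'a set \<Rightarrow> 'a set" where
  "conjugate_subgroup G h Q = (\<lambda>q. h \<otimes>\<^bsub>G\<^esub> q \<otimes>\<^bsub>G\<^esub> inv\<^bsub>G\<^esub> h) ` Q"

definition commensurator :: "('a, 'b) monoid_scheme \<Rightarrow> 'a set \<Rightarrow> 'a set" where
  "commensurator G Q = {h \<in> carrier G.
     finite_index_in G (conjugate_subgroup G h Q \<inter> Q) Q \<and>
     finite_index_in G (conjugate_subgroup G h Q \<inter> Q) (conjugate_subgroup G h Q)}"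

definition quasi_normal :: "('a, 'b) monoid_scheme \<Rightarrow> 'a set \<Rightarrow> bool" where
  "quasi_normal G Q \<longleftrightarrow> subgroup Q G \<and> commensurator G Q = carrier G"


section \<open>Hyperbolic metric spaces and their boundaries\<close>

text \<open>Here \<open>d\<close> is a metric on the set \<open>M\<close> and \<open>b\<close> is a base point in \<open>M\<close>.\<close>

definition gromov_product :: "('a \<Rightarrow> 'a \<Rightarrow> real) \<Rightarrow> 'a \<Rightarrow> 'a \<Rightarrow> 'a \<Rightarrow> real" where
  "gromov_product d b x y = (d x b + d y b - d x y) / 2"

definition gromov_hyperbolic :: "'a set \<Rightarrow> ('a \<Rightarrow> 'a \<Rightarrow> real) \<Rightarrow> bool" where
  "gromov_hyperbolic M d \<longleftrightarrow> (\<exists>\<delta>. \<forall>x\<in>M. \<forall>y\<in>M. \<forall>z\<in>M. \<forall>w\<in>M.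
     gromov_product d w x z \<ge> min (gromov_product d w x y) (gromov_product d w y z) - \<delta>)"

text \<open>In the next two definitions, the two indices tend to infinity independently.\<close>

definition converges_at_infinity ::
    "'a set \<Rightarrow> ('a \<Rightarrow> 'a \<Rightarrow> real) \<Rightarrow> 'a \<Rightarrow> (nat \<Rightarrow> 'a) \<Rightarrow> bool" where
  "converges_at_infinity M d b u \<longleftrightarrow> range u \<subseteq> M \<and>
     filterlim (\<lambda>(i, j). gromov_product d b (u i) (u j)) at_top (sequentially \<times>\<^sub>F sequentially)"

definition boundary_rel ::
    "'a set \<Rightarrow> ('a \<Rightarrow> 'a \<Rightarrow> real) \<Rightarrow> 'a \<Rightarrow> ((nat \<Rightarrow> 'a) \<times> (nat \<Rightarrow> 'a)) set" where
  "boundary_rel M d b = {(u, v). converges_at_infinity M d b u \<and> converges_at_infinity M d b v \<and>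
     filterlim (\<lambda>(i, j). gromov_product d b (u i) (v j)) at_top (sequentially \<times>\<^sub>F sequentially)}"

definition gromov_boundary ::
    "'a set \<Rightarrow> ('a \<Rightarrow> 'a \<Rightarrow> real) \<Rightarrow> 'a \<Rightarrow> (nat \<Rightarrow> 'a) set set" where
  "gromov_boundary M d b = {u. converges_at_infinity M d b u} // boundary_rel M d b"

text \<open>
  The union of the space and its boundary is a disjoint sum: \<open>Inl x\<close> is a point of the
  space and \<open>Inr \<xi>\<close> is a boundary point. The set \<open>boundary_nhd M d b \<xi> r\<close> is the usual basic
  neighbourhood of \<open>\<xi>\<close>: the points whose Gromov product with \<open>\<xi>\<close>, computed along
  some representing sequences, is at least \<open>r\<close>.
\<close>

definition boundary_nhd ::
    "'a set \<Rightarrow> ('a \<Rightarrow> 'a \<Rightarrow> real) \<Rightarrow> 'a \<Rightarrow> (nat \<Rightarrow> 'a) set \<Rightarrow> real \<Rightarrow> ('a + (nat \<Rightarrow> 'a) set) set" where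
  "boundary_nhd M d b \<xi> r =
     Inl ` {y \<in> M. \<exists>u\<in>\<xi>. ereal r \<le> liminf (\<lambda>i. ereal (gromov_product d b (u i) y))} \<union>
     Inr ` {\<eta> \<in> gromov_boundary M d b. \<exists>u\<in>\<xi>. \<exists>v\<in>\<eta>.
       ereal r \<le> Liminf (sequentially \<times>\<^sub>F sequentially)
         (\<lambda>(i, j). ereal (gromov_product d b (u i) (v j)))}"

text \<open>Points of \<open>M\<close> keep their metric neighbourhoods.\<close>

definition bordification_open ::
    "'a set \<Rightarrow> ('a \<Rightarrow> 'a \<Rightarrow> real) \<Rightarrow> 'a \<Rightarrow> ('a + (nat \<Rightarrow> 'a) set) set \<Rightarrow> bool" where
  "bordification_open M d b U \<longleftrightarrow>
     U \<subseteq> Inl ` M \<union> Inr ` gromov_boundary M d b \<and>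
     (\<forall>x. Inl x \<in> U \<longrightarrow> (\<exists>\<epsilon>>0. \<forall>y\<in>M. d x y < \<epsilon> \<longrightarrow> Inl y \<in> U)) \<and>
     (\<forall>\<xi>. Inr \<xi> \<in> U \<longrightarrow> (\<exists>r. boundary_nhd M d b \<xi> r \<subseteq> U))"

definition bordification ::
    "'a set \<Rightarrow> ('a \<Rightarrow> 'a \<Rightarrow> real) \<Rightarrow> 'a \<Rightarrow> ('a + (nat \<Rightarrow> 'a) set) topology" where
  "bordification M d b = topology (bordification_open M d b)"

lemma boundary_nhd_antimono:
  assumes "r \<le> s"
  shows "boundary_nhd M d b \<xi> s \<subseteq> boundary_nhd M d b \<xi> r"
proof -
  have "ereal r \<le> l" if "ereal s \<le> l" for l
    using assms that by (meson ereal_less_eq(3) order_trans)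
  then show ?thesis
    unfolding boundary_nhd_def by (intro Un_mono image_mono) auto
qed

lemma istopology_bordification_open: "istopology (bordification_open M d b)"
  unfolding istopology_def
proof (intro conjI allI impI)
  fix U V
  assume U: "bordification_open M d b U" and V: "bordification_open M d b V"
  show "bordification_open M d b (U \<inter> V)"
    unfolding bordification_open_def
  proof (intro conjI allI impI)
    show "U \<inter> V \<subseteq> Inl ` M \<union> Inr ` gromov_boundary M d b"
      using U unfolding bordification_open_def by (elim conjE) (rule le_infI1)
  next
    fix x assume "Inl x \<in> U \<inter> V"
    then have "\<exists>e>0. \<forall>y\<in>M. d x y < e \<longrightarrow> Inl y \<in> U" "\<exists>f>0. \<forall>y\<in>M. d x y < f \<longrightarrow> Inl y \<in> V"
      using U V unfolding bordification_open_def by simp_all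
    then obtain e f where "e > 0" "\<forall>y\<in>M. d x y < e \<longrightarrow> Inl y \<in> U"
        "f > 0" "\<forall>y\<in>M. d x y < f \<longrightarrow> Inl y \<in> V"
      by (elim exE conjE)
    then show "\<exists>\<epsilon>>0. \<forall>y\<in>M. d x y < \<epsilon> \<longrightarrow> Inl y \<in> U \<inter> V"
      by (intro exI[of _ "min e f"]) auto
  next
    fix \<xi> assume "Inr \<xi> \<in> U \<inter> V"
    then have "\<exists>r. boundary_nhd M d b \<xi> r \<subseteq> U" "\<exists>s. boundary_nhd M d b \<xi> s \<subseteq> V"
      using U V unfolding bordification_open_def by simp_all
    then obtain r s where "boundary_nhd M d b \<xi> r \<subseteq> U" "boundary_nhd M d b \<xi> s \<subseteq> V"
      by (elim exE)
    then show "\<exists>r. boundary_nhd M d b \<xi> r \<subseteq> U \<inter> V"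
      using boundary_nhd_antimono[of r "max r s" M d b \<xi>]
        boundary_nhd_antimono[of s "max r s" M d b \<xi>]
      by (intro exI[of _ "max r s"]) auto
  qed
next
  fix \<K>
  assume K: "\<forall>K\<in>\<K>. bordification_open M d b K"
  show "bordification_open M d b (\<Union>\<K>)"
    unfolding bordification_open_def
  proof (intro conjI allI impI)
    show "\<Union>\<K> \<subseteq> Inl ` M \<union> Inr ` gromov_boundary M d b"
      using K unfolding bordification_open_def by (intro Union_least) (elim ballE conjE, auto)
  next
    fix x assume "Inl x \<in> \<Union>\<K>"
    then obtain V where V: "V \<in> \<K>" "Inl x \<in> V" by blast
    have "bordification_open M d b V"
      using K V(1) by (rule bspec)
    then have "\<exists>\<epsilon>>0. \<forall>y\<in>M. d x y < \<epsilon> \<longrightarrow> Inl y \<in> V"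
      using V(2) unfolding bordification_open_def by simp
    then show "\<exists>\<epsilon>>0. \<forall>y\<in>M. d x y < \<epsilon> \<longrightarrow> Inl y \<in> \<Union>\<K>"
      using V(1) by blast
  next
    fix \<xi> assume "Inr \<xi> \<in> \<Union>\<K>"
    then obtain V where V: "V \<in> \<K>" "Inr \<xi> \<in> V" by blast
    have "bordification_open M d b V"
      using K V(1) by (rule bspec)
    then have "\<exists>r. boundary_nhd M d b \<xi> r \<subseteq> V"
      using V(2) unfolding bordification_open_def by simp
    then show "\<exists>r. boundary_nhd M d b \<xi> r \<subseteq> \<Union>\<K>"
      using V(1) by blast
  qed
qed

lemma openin_bordification: "openin (bordification M d b) U \<longleftrightarrow> bordification_open M d b U"
  unfolding bordification_def by (simp add: istopology_bordification_open topology_inverse')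


section \<open>Word hyperbolic groups\<close>

definition finite_generating_set :: "('a, 'b) monoid_scheme \<Rightarrow> 'a set \<Rightarrow> bool" where
  "finite_generating_set G S \<longleftrightarrow> finite S \<and> S \<subseteq> carrier G \<and> generate G S = carrier G"

definition cayley_adj :: "('a, 'b) monoid_scheme \<Rightarrow> 'a set \<Rightarrow> ('a \<times> 'a) set" where
  "cayley_adj G S = {(g, h). g \<in> carrier G \<and> h \<in> carrier G \<and>
     (\<exists>s\<in>S. h = g \<otimes>\<^bsub>G\<^esub> s \<or> g = h \<otimes>\<^bsub>G\<^esub> s)}"

text \<open>
  The path metric on the vertices of the Cayley graph (the word metric). \<open>LEAST\<close> is
  meaningful because the graph is connected when \<open>S\<close> generates \<open>G\<close>.
\<close>

definition cayley_dist :: "('a, 'b) monoid_scheme \<Rightarrow> 'a set \<Rightarrow> 'a \<Rightarrow> 'a \<Rightarrow> real" where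
  "cayley_dist G S g h = real (LEAST n. (g, h) \<in> cayley_adj G S ^^ n)"

definition word_hyperbolic :: "('a, 'b) monoid_scheme \<Rightarrow> bool" where
  "word_hyperbolic G \<longleftrightarrow> group G \<and>
     (\<exists>S. finite_generating_set G S \<and> gromov_hyperbolic (carrier G) (cayley_dist G S))"

definition group_boundary :: "('a, 'b) monoid_scheme \<Rightarrow> 'a set \<Rightarrow> (nat \<Rightarrow> 'a) set set" where
  "group_boundary G S = gromov_boundary (carrier G) (cayley_dist G S) \<one>\<^bsub>G\<^esub>"

definition limit_set :: "('a, 'b) monoid_scheme \<Rightarrow> 'a set \<Rightarrow> 'a set \<Rightarrow> (nat \<Rightarrow> 'a) set set" where
  "limit_set G S Q = {\<xi> \<in> group_boundary G S.
     Inr \<xi> \<in> bordification (carrier G) (cayley_dist G S) \<one>\<^bsub>G\<^esub> derived_set_of (Inl ` Q)}"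

end

theory Submission
  imports Defs "HOL-Real_Asymp.Real_Asymp"
begin

text \<open>
  Let \<open>u\<close> converge to a boundary point and let \<open>h\<close> be a late term of \<open>u\<close>. Since \<open>h\<close>
  commensurates \<open>Q\<close>, the coset \<open>h Q\<close> lies in a bounded neighbourhood of \<open>Q\<close>. As \<open>Q\<close> is
  infinite, it has two distinct limit points, so there are far points \<open>q\<close> of \<open>Q\<close> with
  bounded Gromov product \<open>(inv h | q)\<close> at \<open>\<one>\<close>. Then \<open>(h | h q)\<close> is \<open>|h|\<close> up to a
  constant, and a point of \<open>Q\<close> near \<open>h q\<close> is close to the limit of \<open>u\<close>.

  Hyperbolicity is given for one generating set and the boundary is taken for another one. It is
  not necessary to transport the four-point condition: it suffices that the Gromov products for
  the two word metrics bound each other up to affine maps. This follows from one half of the Morse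
  lemma, namely that geodesics of the hyperbolic word metric stay close to geodesics of the other.
\<close>

section \<open>Spaces with integral geodesic distances\<close>

text \<open>The model is the vertex set of a connected graph. \<open>interval_point\<close> replaces
  geodesic segments, so edges never have to be realised as intervals.\<close>

locale nat_geodesic_space = Metric_space +
  assumes dist_in_Nats: "x \<in> M \<Longrightarrow> y \<in> M \<Longrightarrow> d x y \<in> \<nat>"
    and interval_point: "x \<in> M \<Longrightarrow> y \<in> M \<Longrightarrow> real n \<le> d x y \<Longrightarrow>
      \<exists>z\<in>M. d x z = real n \<and> d z y = d x y - real n"
begin

abbreviation gprod :: "'a \<Rightarrow> 'a \<Rightarrow> 'a \<Rightarrow> real" where
  "gprod \<equiv> gromov_product d"

lemma gprod_commute: "gprod w x y = gprod w y x"
  by (simp add: gromov_product_def commute)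

lemma gprod_nonneg: "x \<in> M \<Longrightarrow> y \<in> M \<Longrightarrow> w \<in> M \<Longrightarrow> 0 \<le> gprod w x y"
  using triangle[of x w y] commute[of w y] by (simp add: gromov_product_def)

lemma gprod_le_dist: "x \<in> M \<Longrightarrow> y \<in> M \<Longrightarrow> w \<in> M \<Longrightarrow> gprod w x y \<le> d w x"
  using triangle[of w x y] commute[of w x] commute[of w y] by (simp add: gromov_product_def)

lemma gprod_ge_dist_minus: "x \<in> M \<Longrightarrow> y \<in> M \<Longrightarrow> w \<in> M \<Longrightarrow> d w x - d x y \<le> gprod w x y"
  using triangle[of w y x] commute[of w x] commute[of w y] commute[of x y]
  by (simp add: gromov_product_def)

lemma gprod_le_of_near:
  assumes "x \<in> M" "y \<in> M" "w \<in> M" "c \<in> M" "d x c + d c y \<le> d x y + R"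
  shows "gprod w x y \<le> d w c + R / 2"
  using assms triangle[of x c w] triangle[of y c w] commute[of y c] commute[of w c]
  by (simp add: gromov_product_def)

lemma isometric_path_exists:
  assumes "x \<in> M" "y \<in> M" "d x y = real n"
  shows "\<exists>\<gamma>. \<gamma> 0 = x \<and> \<gamma> n = y \<and> (\<forall>k\<le>n. \<gamma> k \<in> M) \<and>
    (\<forall>i j. i \<le> j \<longrightarrow> j \<le> n \<longrightarrow> d (\<gamma> i) (\<gamma> j) = real (j - i))"
  using assms
proof (induction n arbitrary: y)
  case 0
  then show ?case by (intro exI[of _ "\<lambda>_. x"]) auto
next
  case (Suc n)
  obtain z where z: "z \<in> M" "d x z = real n" "d z y = 1"
    using interval_point[of x y n] Suc.prems by auto
  obtain \<gamma> where \<gamma>: "\<gamma> 0 = x" "\<gamma> n = z" "\<And>k. k \<le> n \<Longrightarrow> \<gamma> k \<in> M"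
      "\<And>i j. i \<le> j \<Longrightarrow> j \<le> n \<Longrightarrow> d (\<gamma> i) (\<gamma> j) = real (j - i)"
    using Suc.IH[OF Suc.prems(1) z(1,2)] by blast
  \<comment> \<open>Passing through \<open>z\<close> gives the upper bound; the lower one comes from
    \<open>d x y = Suc n\<close>.\<close>
  have last: "d (\<gamma> i) y = real (Suc n - i)" if "i \<le> n" for i
    using \<gamma>(1,2) \<gamma>(3)[OF that] \<gamma>(4)[of 0 i] \<gamma>(4)[of i n] that Suc.prems z
      triangle[of "\<gamma> i" z y] triangle[of x "\<gamma> i" y]
    by (simp add: of_nat_diff)
  show ?case
    by (rule exI[of _ "\<gamma>(Suc n := y)"]) (use \<gamma> last Suc.prems in \<open>auto simp: le_Suc_eq\<close>)
qed

end

section \<open>Hyperbolic spaces and quasi-geodesics\<close>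

locale hyperbolic_nat_space = nat_geodesic_space +
  fixes \<delta> :: real
  assumes \<delta>_pos: "\<delta> > 0"
    and four_point: "x \<in> M \<Longrightarrow> y \<in> M \<Longrightarrow> z \<in> M \<Longrightarrow> w \<in> M \<Longrightarrow>
      min (gprod w x y) (gprod w y z) - \<delta> \<le> gprod w x z"
begin

text \<open>Halving the path costs one \<open>\<delta>\<close>, so the loss is only logarithmic in the length.\<close>

lemma gprod_path_ends_ge:
  assumes "w \<in> M" "K \<ge> 0" "i \<le> j" "j \<le> i + 2 ^ n"
    and "\<And>k. i \<le> k \<Longrightarrow> k \<le> j \<Longrightarrow> \<gamma> k \<in> M"
    and "\<And>k. i \<le> k \<Longrightarrow> k \<le> j \<Longrightarrow> D \<le> d w (\<gamma> k)"
    and "\<And>k. i \<le> k \<Longrightarrow> k < j \<Longrightarrow> d (\<gamma> k) (\<gamma> (Suc k)) \<le> K"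
  shows "D - K - real n * \<delta> \<le> gprod w (\<gamma> i) (\<gamma> j)"
  using assms(3-)
proof (induction n arbitrary: i j)
  case 0
  then consider "j = i" | "j = Suc i" by fastforce
  then have "d (\<gamma> i) (\<gamma> j) \<le> K"
    by cases (use 0 \<open>K \<ge> 0\<close> in auto)
  then show ?case
    using 0 gprod_ge_dist_minus[of "\<gamma> i" "\<gamma> j" w] \<open>w \<in> M\<close> by force
next
  case (Suc n)
  define m where "m = min j (i + 2 ^ n)"
  have m: "i \<le> m" "m \<le> j" "m \<le> i + 2 ^ n" "j \<le> m + 2 ^ n"
    using Suc.prems(1,2) by (auto simp: m_def)
  have "D - K - real n * \<delta> \<le> gprod w (\<gamma> i) (\<gamma> m)"
    using m Suc.prems by (intro Suc.IH) auto
  moreover have "D - K - real n * \<delta> \<le> gprod w (\<gamma> m) (\<gamma> j)"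
    using m Suc.prems by (intro Suc.IH) auto
  moreover have "min (gprod w (\<gamma> i) (\<gamma> m)) (gprod w (\<gamma> m) (\<gamma> j)) - \<delta> \<le> gprod w (\<gamma> i) (\<gamma> j)"
    using m Suc.prems \<open>w \<in> M\<close> by (intro four_point) auto
  ultimately show ?case
    by (simp add: algebra_simps)
qed

text \<open>A logarithm grows slower than the identity. In the Morse argument this turns a bound of
  a distance by its own logarithm into an absolute bound.\<close>

lemma log_bound_exists:
  assumes "L > 0"
  shows "\<exists>D0\<ge>a. \<forall>D>D0. a + \<delta> * real (nat \<lceil>log 2 (L * D)\<rceil>) < D"
proof -
  have "eventually (\<lambda>D. \<bar>a\<bar> + \<delta> * (\<bar>log 2 (L * D)\<bar> + 1) < D) at_top"
    using assms \<delta>_pos by real_asymp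
  then obtain D0 where D0: "\<And>D. D \<ge> D0 \<Longrightarrow> \<bar>a\<bar> + \<delta> * (\<bar>log 2 (L * D)\<bar> + 1) < D"
    by (auto simp: eventually_at_top_linorder)
  have "a + \<delta> * real (nat \<lceil>log 2 (L * D)\<rceil>) < D" if "D > max a D0" for D
  proof -
    have "real (nat \<lceil>log 2 (L * D)\<rceil>) \<le> \<bar>log 2 (L * D)\<bar> + 1"
      by linarith
    then have "\<delta> * real (nat \<lceil>log 2 (L * D)\<rceil>) \<le> \<delta> * (\<bar>log 2 (L * D)\<bar> + 1)"
      using \<delta>_pos by (intro mult_left_mono) auto
    then show ?thesis
      using D0[of D] that by linarith
  qed
  then show ?thesis
    by (intro exI[of _ "max a D0"]) auto
qed

text \<open>
  This is the half of the Morse lemma that the comparison of word metrics needs. In its proof,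
  \<open>p\<close> is a point of the geodesic at maximal distance \<open>n\<close> from the quasi-geodesic. Points at
  distance at most \<open>2 n\<close> on both sides of \<open>p\<close> are close to quasi-geodesic points whose
  indices differ by \<open>O(n)\<close>, and the logarithmic estimate bounds \<open>n\<close>.
\<close>

lemma geodesic_near_quasi_geodesic:
  assumes "K \<ge> 0" "L > 0"
  obtains D0 where "\<And>\<gamma> N c. \<lbrakk>\<And>k. k \<le> N \<Longrightarrow> \<gamma> k \<in> M; \<And>k. k < N \<Longrightarrow> d (\<gamma> k) (\<gamma> (Suc k)) \<le> K;
    \<And>i j. i \<le> j \<Longrightarrow> j \<le> N \<Longrightarrow> real (j - i) \<le> L * d (\<gamma> i) (\<gamma> j);
    c \<in> M; d (\<gamma> 0) c + d c (\<gamma> N) = d (\<gamma> 0) (\<gamma> N)\<rbrakk> \<Longrightarrow> \<exists>k\<le>N. d c (\<gamma> k) \<le> D0"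
proof -
  \<comment> \<open>\<open>K + 2 * \<delta>\<close> collects the step size and two uses of
    \<open>four_point\<close>; the factor 6 is the one in \<open>dij\<close> below.\<close>
  obtain D0 where D0: "D0 \<ge> K + 2 * \<delta>"
    "\<And>D. D > D0 \<Longrightarrow> K + 2 * \<delta> + \<delta> * real (nat \<lceil>log 2 ((L * 6) * D)\<rceil>) < D"
    using log_bound_exists[of "L * 6" "K + 2 * \<delta>"] assms by auto
  show thesis
  proof (rule that[of D0])
    fix \<gamma> N c
    assume \<gamma>M: "\<And>k. k \<le> N \<Longrightarrow> \<gamma> k \<in> M" and step: "\<And>k. k < N \<Longrightarrow> d (\<gamma> k) (\<gamma> (Suc k)) \<le> K"
      and qg: "\<And>i j. i \<le> j \<Longrightarrow> j \<le> N \<Longrightarrow> real (j - i) \<le> L * d (\<gamma> i) (\<gamma> j)"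
      and c: "c \<in> M" "d (\<gamma> 0) c + d c (\<gamma> N) = d (\<gamma> 0) (\<gamma> N)"
    define x y where "x = \<gamma> 0" and "y = \<gamma> N"
    have xy: "x \<in> M" "y \<in> M"
      using \<gamma>M by (auto simp: x_def y_def)
    \<comment> \<open>All points between \<open>x\<close> and \<open>y\<close> are treated at once,
      so no geodesic through \<open>c\<close> has to be chosen.\<close>
    define I where "I = {p \<in> M. d x p + d p y = d x y}"
    define P where "P n \<longleftrightarrow> (\<exists>p\<in>I. \<forall>k\<le>N. real n \<le> d p (\<gamma> k))" for n
    have cI: "c \<in> I"
      using c by (simp add: I_def x_def y_def)
    have "P 0"
      using cI by (auto simp: P_def)
    moreover have "\<forall>n. P n \<longrightarrow> n \<le> nat \<lceil>d x y\<rceil>"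
    proof (intro allI impI)
      fix n assume "P n"
      then obtain p where p: "p \<in> I" "real n \<le> d p x"
        by (auto simp: P_def x_def)
      moreover have "d x p + d p y = d x y"
        using p(1) by (simp add: I_def)
      ultimately have "real n \<le> d x y"
        using commute[of p x] nonneg[of p y] by linarith
      then show "n \<le> nat \<lceil>d x y\<rceil>"
        by linarith
    qed
    ultimately obtain n where n: "P n" "\<And>m. P m \<Longrightarrow> m \<le> n"
      using Nat.ex_has_greatest_nat[of P 0 "nat \<lceil>d x y\<rceil>"] by blast
    obtain p where p: "p \<in> I" "\<And>k. k \<le> N \<Longrightarrow> real n \<le> d p (\<gamma> k)"
      using n(1) by (auto simp: P_def)
    have pM: "p \<in> M" and pxy: "d x p + d p y = d x y"
      using p by (auto simp: I_def)
    \<comment> \<open>Maximality of \<open>n\<close> gives a distance below \<open>n + 1\<close>,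
      and distances are integers.\<close>
    have near: "\<exists>k\<le>N. d q (\<gamma> k) \<le> real n" if q: "q \<in> I" for q
    proof -
      have "\<not> P (Suc n)"
        using n(2) by force
      then obtain k where k: "k \<le> N" "d q (\<gamma> k) < real (Suc n)"
        using q unfolding P_def by fastforce
      then obtain m where "d q (\<gamma> k) = real m"
        using dist_in_Nats[of q "\<gamma> k"] q \<gamma>M by (auto simp: I_def elim: Nats_cases)
      then show ?thesis
        using k by auto
    qed
    \<comment> \<open>Used once from each end. The witness \<open>y0\<close> lies at distance
      \<open>2 * n\<close> from \<open>p\<close> towards \<open>e\<close>, or is \<open>e\<close>
      itself if \<open>e\<close> is closer; in that case it is already on the path, hence at
      distance at least \<open>n\<close> from \<open>p\<close>.\<close>
    have side: "\<exists>y0\<in>M. \<exists>i\<le>N. d e y0 + d y0 p = d e p \<and> d p y0 \<le> 2 * n \<and> d y0 (\<gamma> i) \<le> n \<and>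
        real n \<le> gprod p y0 (\<gamma> i)"
      if e: "e \<in> M" "e' \<in> M" "s \<le> N" "e = \<gamma> s" "d e p + d p e' = d e e'"
        and near': "\<And>q. q \<in> M \<Longrightarrow> d e q + d q e' = d e e' \<Longrightarrow> \<exists>k\<le>N. d q (\<gamma> k) \<le> real n"
      for e e' s
    proof (cases "real (2 * n) \<le> d p e")
      case True
      then obtain z where z: "z \<in> M" "d p z = real (2 * n)" "d z e = d p e - real (2 * n)"
        using interval_point pM e by blast
      then have "d e z + d z e' = d e e'"
        using e pM triangle[of z p e'] triangle[of e z e'] commute[of e z] commute[of p z]
          commute[of p e] by linarith
      then obtain k where k: "k \<le> N" "d z (\<gamma> k) \<le> real n"
        using near' z by blast
      have "real n \<le> gprod p z (\<gamma> k)"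
        using gprod_ge_dist_minus[of z "\<gamma> k" p] z k \<gamma>M pM by force
      then show ?thesis
        using z k e commute[of e z] commute[of p z] commute[of p e] by force
    next
      case False
      have "gprod p e e = d e p"
        using e by (simp add: gromov_product_def)
      then show ?thesis
        using False e p(2)[of s] commute[of p e] by (intro bexI[of _ e] exI[of _ s]) auto
    qed
    obtain y0 i where y0: "y0 \<in> M" "i \<le> N" "d x y0 + d y0 p = d x p" "d p y0 \<le> 2 * n"
        "d y0 (\<gamma> i) \<le> n" "real n \<le> gprod p y0 (\<gamma> i)"
      using side[of x y 0] xy near pxy by (auto simp: x_def I_def)
    have "\<exists>z0\<in>M. \<exists>i\<le>N. d y z0 + d z0 p = d y p \<and> d p z0 \<le> 2 * n \<and> d z0 (\<gamma> i) \<le> n \<and>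
        real n \<le> gprod p z0 (\<gamma> i)"
    proof (rule side[of y x N])
      show "\<exists>k\<le>N. d q (\<gamma> k) \<le> real n" if "q \<in> M" "d y q + d q x = d y x" for q
        using near[of q] that commute[of y q] commute[of q x] commute[of y x]
        by (simp add: I_def add.commute)
    qed (use xy pxy commute[of y p] commute[of p x] commute[of y x] in \<open>auto simp: y_def\<close>)
    then obtain z0 j where z0: "z0 \<in> M" "j \<le> N" "d y z0 + d z0 p = d y p" "d p z0 \<le> 2 * n"
        "d z0 (\<gamma> j) \<le> n" "real n \<le> gprod p z0 (\<gamma> j)"
      by blast
    have "n \<le> D0"
    proof (rule ccontr)
      assume "\<not> n \<le> D0"
      then have nD0: "real n > D0" by simp
      define m where "m = nat \<lceil>log 2 ((L * 6) * n)\<rceil>"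
      have n_big: "K + 2 * \<delta> + \<delta> * real m < real n"
        using D0(2)[OF nD0] by (simp add: m_def)
      have npos: "0 < real n"
        using nD0 D0(1) \<delta>_pos assms by linarith
      \<comment> \<open>\<open>y0\<close> and \<open>z0\<close> lie on opposite sides of
        \<open>p\<close>, so \<open>p\<close> is between them.\<close>
      have y0z0: "gprod p y0 z0 \<le> 0"
        using xy y0 z0 pxy triangle[of x y0 y] triangle[of y0 z0 y] commute[of y z0]
          commute[of y p] by (simp add: gromov_product_def)
      \<comment> \<open>The products of \<open>y0\<close> with \<open>\<gamma> i\<close> and of
        \<open>z0\<close> with \<open>\<gamma> j\<close> are at least
        \<open>n > 2 * \<delta>\<close>, so each minimum is attained by the other entry.\<close>
      have "min (gprod p y0 (\<gamma> i)) (gprod p (\<gamma> i) z0) - \<delta> \<le> gprod p y0 z0"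
        "min (gprod p (\<gamma> i) (\<gamma> j)) (gprod p (\<gamma> j) z0) - \<delta> \<le> gprod p (\<gamma> i) z0"
        using four_point y0 z0 \<gamma>M pM by auto
      then have upper: "gprod p (\<gamma> i) (\<gamma> j) \<le> 2 * \<delta>"
        using y0z0 y0(6) z0(6) nD0 D0(1) assms gprod_commute[of p z0 "\<gamma> j"]
        by linarith
      \<comment> \<open>The route through \<open>y0\<close>, \<open>p\<close> and \<open>z0\<close>
        has length at most \<open>n + 2 * n + 2 * n + n\<close>.\<close>
      have dij: "d (\<gamma> i) (\<gamma> j) \<le> 6 * n"
        using triangle[of "\<gamma> i" y0 "\<gamma> j"] triangle[of y0 p "\<gamma> j"] triangle[of p z0 "\<gamma> j"]
          \<gamma>M y0 z0 pM commute[of y0 p] commute[of "\<gamma> i" y0] by auto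
      have pow: "(L * 6) * n \<le> 2 ^ m"
      proof -
        have "(L * 6) * n = 2 powr (log 2 ((L * 6) * n))"
          using assms npos by simp
        also have "\<dots> \<le> 2 powr real m"
          unfolding m_def by (intro powr_mono) linarith+
        finally show ?thesis
          by (simp add: powr_realpow)
      qed
      \<comment> \<open>It is not known which of \<open>i\<close> and \<open>j\<close> is smaller,
        hence the general indices. The path between them has at most \<open>2 ^ m\<close> steps and
        keeps distance at least \<open>n\<close> from \<open>p\<close>.\<close>
      have "real n - K - real m * \<delta> \<le> gprod p (\<gamma> k) (\<gamma> l)"
        if kl: "k \<le> l" "l \<le> N" "d (\<gamma> k) (\<gamma> l) \<le> 6 * n" for k l
      proof (rule gprod_path_ends_ge)
        have "real (l - k) \<le> L * (6 * n)"
          using qg[of k l] kl assms mult_left_mono[OF kl(3), of L] by linarith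
        also have "\<dots> \<le> real (2 ^ m)"
          using pow by (simp add: mult.assoc)
        finally have "l - k \<le> 2 ^ m"
          by (simp only: of_nat_le_iff)
        then show "l \<le> k + 2 ^ m"
          by linarith
      qed (use kl p(2) pM \<gamma>M assms step in auto)
      then have "real n - K - real m * \<delta> \<le> gprod p (\<gamma> i) (\<gamma> j)"
        using y0(2) z0(2) dij gprod_commute[of p "\<gamma> i" "\<gamma> j"] commute[of "\<gamma> i" "\<gamma> j"]
        by (metis nat_le_linear)
      then show False
        using upper n_big by (simp add: mult.commute)
    qed
    then show "\<exists>k\<le>N. d c (\<gamma> k) \<le> D0"
      using near[OF cI] by force
  qed
qed

text \<open>Geodesics from \<open>w\<close> stay together up to length \<open>gprod w x y\<close>:
  along the chain \<open>p\<close>, \<open>x\<close>, \<open>y\<close>, \<open>q\<close> consecutive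
  products are at least \<open>t\<close>, and two uses of \<open>four_point\<close> lose
  \<open>2 * \<delta>\<close>.\<close>

lemma equidistant_points_near:
  assumes "w \<in> M" "x \<in> M" "y \<in> M" "p \<in> M" "q \<in> M"
    and "d w p + d p x = d w x" "d w q + d q y = d w y" "d w p = t" "d w q = t"
    and "t \<le> gprod w x y"
  shows "d p q \<le> 4 * \<delta>"
proof -
  have "gprod w p x = t" "gprod w y q = t"
    using assms commute[of w] commute[of y q] by (auto simp: gromov_product_def)
  moreover have "min (gprod w p x) (gprod w x q) - \<delta> \<le> gprod w p q"
    "min (gprod w x y) (gprod w y q) - \<delta> \<le> gprod w x q"
    using four_point assms by auto
  ultimately have "t - 2 * \<delta> \<le> gprod w p q"
    using assms \<delta>_pos by linarith
  then show ?thesis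
    using assms commute[of w] by (simp add: gromov_product_def)
qed

text \<open>A converse to \<open>gprod_le_of_near\<close>. Walking \<open>t\<close> steps from
  \<open>x\<close> towards \<open>y\<close> and towards \<open>w\<close> gives close points
  \<open>c\<close> and \<open>p\<close>, and \<open>p\<close> is at distance
  \<open>d x w - t\<close> from \<open>w\<close>. The summand 1 comes from rounding \<open>t\<close>
  down.\<close>

lemma interval_point_near_base:
  assumes "w \<in> M" "x \<in> M" "y \<in> M"
  shows "\<exists>c\<in>M. d x c + d c y = d x y \<and> d w c \<le> gprod w x y + 1 + 4 * \<delta>"
proof -
  define t where "t = nat \<lfloor>gprod x w y\<rfloor>"
  have t: "real t \<le> gprod x w y" "gprod x w y \<le> real t + 1"
    using gprod_nonneg[of w y x] assms unfolding t_def by linarith+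
  obtain c where c: "c \<in> M" "d x c = t" "d c y = d x y - t"
    using interval_point[of x y t] t gprod_le_dist[of y w x] gprod_commute[of x w y] assms by auto
  obtain p where p: "p \<in> M" "d x p = t" "d p w = d x w - t"
    using interval_point[of x w t] t gprod_le_dist[of w y x] assms by auto
  have "d p c \<le> 4 * \<delta>"
    using equidistant_points_near[of x w y p c "real t"] c p t assms by auto
  moreover have "d w c \<le> d p w + d p c"
    using triangle[of w p c] assms c p commute[of w p] by auto
  moreover have "gprod x w y + gprod w x y = d x w"
    using commute[of x w] commute[of y x] commute[of y w] by (simp add: gromov_product_def field_simps)
  ultimately show ?thesis
    using c p t by (intro bexI[of _ c]) auto
qed

end

section \<open>Gromov products of bilipschitz metrics\<close>

locale bilipschitz_metrics = X: nat_geodesic_space M d + Y: hyperbolic_nat_space M d' \<delta>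
  for M :: "'a set" and d d' \<delta> +
  fixes K :: real
  assumes K_pos: "K > 0"
    and d_le: "x \<in> M \<Longrightarrow> y \<in> M \<Longrightarrow> d x y \<le> K * d' x y"
    and d'_le: "x \<in> M \<Longrightarrow> y \<in> M \<Longrightarrow> d' x y \<le> K * d x y"
begin

text \<open>A \<open>d\<close>-geodesic is a quasi-geodesic for \<open>d'\<close>, so
  \<open>c\<close> is near one of its points, and the detour through \<open>c\<close> costs at most
  twice that distance.\<close>

lemma hyperbolic_interval_almost_interval:
  "\<exists>R. \<forall>x\<in>M. \<forall>y\<in>M. \<forall>c\<in>M. d' x c + d' c y = d' x y \<longrightarrow> d x c + d c y \<le> d x y + R"
proof -
  obtain D0 where D0: "\<And>\<gamma> N c. \<lbrakk>\<And>k. k \<le> N \<Longrightarrow> \<gamma> k \<in> M; \<And>k. k < N \<Longrightarrow> d' (\<gamma> k) (\<gamma> (Suc k)) \<le> K;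
    \<And>i j. i \<le> j \<Longrightarrow> j \<le> N \<Longrightarrow> real (j - i) \<le> K * d' (\<gamma> i) (\<gamma> j);
    c \<in> M; d' (\<gamma> 0) c + d' c (\<gamma> N) = d' (\<gamma> 0) (\<gamma> N)\<rbrakk> \<Longrightarrow> \<exists>k\<le>N. d' c (\<gamma> k) \<le> D0"
    using Y.geodesic_near_quasi_geodesic[of K K] K_pos less_imp_le[OF K_pos] by metis
  have "d x c + d c y \<le> d x y + 2 * (K * D0)"
    if H: "x \<in> M" "y \<in> M" "c \<in> M" "d' x c + d' c y = d' x y" for x y c
  proof -
    obtain N where N: "d x y = real N"
      using Nats_cases[OF X.dist_in_Nats[OF H(1,2)]] by blast
    obtain \<gamma> where \<gamma>: "\<gamma> 0 = x" "\<gamma> N = y" "\<And>k. k \<le> N \<Longrightarrow> \<gamma> k \<in> M"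
        "\<And>i j. i \<le> j \<Longrightarrow> j \<le> N \<Longrightarrow> d (\<gamma> i) (\<gamma> j) = real (j - i)"
      using X.isometric_path_exists[OF H(1,2) N] by blast
    have "\<exists>k\<le>N. d' c (\<gamma> k) \<le> D0"
    proof (rule D0)
      show "d' (\<gamma> k) (\<gamma> (Suc k)) \<le> K" if "k < N" for k
        using d'_le[of "\<gamma> k" "\<gamma> (Suc k)"] \<gamma>(3)[of k] \<gamma>(3)[of "Suc k"] \<gamma>(4)[of k "Suc k"] that by simp
      show "real (j - i) \<le> K * d' (\<gamma> i) (\<gamma> j)" if "i \<le> j" "j \<le> N" for i j
        using d_le[of "\<gamma> i" "\<gamma> j"] \<gamma>(3)[of i] \<gamma>(3)[of j] \<gamma>(4)[of i j] that by simp
    qed (use \<gamma> H in auto)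
    then obtain k where k: "k \<le> N" "d' c (\<gamma> k) \<le> D0" by blast
    have "d c (\<gamma> k) \<le> K * D0"
      using d_le[of c "\<gamma> k"] H \<gamma>(3)[OF k(1)] mult_left_mono[OF k(2), of K] K_pos by linarith
    moreover have "d x (\<gamma> k) + d (\<gamma> k) y = d x y"
      using \<gamma>(1,2) \<gamma>(4)[of 0 k] \<gamma>(4)[of k N] k N by (simp add: of_nat_diff)
    ultimately show ?thesis
      using X.triangle[of x "\<gamma> k" c] X.triangle[of c "\<gamma> k" y] H \<gamma>(3)[OF k(1)]
        X.commute[of c "\<gamma> k"] by linarith
  qed
  then show ?thesis by blast
qed

text \<open>The points \<open>p\<close> and \<open>q\<close> at \<open>d'\<close>-distance
  \<open>t\<close> from \<open>w\<close> on the two sides are close to each other and almost on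
  \<open>d\<close>-geodesics. Hence \<open>d x y\<close> falls short of \<open>d w x + d w y\<close>
  by almost \<open>d w p + d w q\<close>, which is at least \<open>2 * t / K\<close>.\<close>

lemma gprod_ge:
  "\<exists>B. \<forall>w\<in>M. \<forall>x\<in>M. \<forall>y\<in>M. Y.gprod w x y / K - B \<le> X.gprod w x y"
proof -
  obtain R where R: "\<And>x y c. x \<in> M \<Longrightarrow> y \<in> M \<Longrightarrow> c \<in> M \<Longrightarrow> d' x c + d' c y = d' x y \<Longrightarrow>
      d x c + d c y \<le> d x y + R"
    using hyperbolic_interval_almost_interval by blast
  have "Y.gprod w x y / K - (1 / K + R + K * (4 * \<delta>)) \<le> X.gprod w x y"
    if H: "w \<in> M" "x \<in> M" "y \<in> M" for w x y
  proof -
    define t where "t = nat \<lfloor>Y.gprod w x y\<rfloor>"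
    have t: "real t \<le> Y.gprod w x y" "Y.gprod w x y \<le> real t + 1"
      using Y.gprod_nonneg[of x y w] H unfolding t_def by linarith+
    obtain p where p: "p \<in> M" "d' w p = t" "d' p x = d' w x - t"
      using Y.interval_point[of w x t] t Y.gprod_le_dist[of x y w] H by auto
    obtain q where q: "q \<in> M" "d' w q = t" "d' q y = d' w y - t"
      using Y.interval_point[of w y t] t Y.gprod_le_dist[of y x w] Y.gprod_commute[of w x y] H by auto
    have "d' p q \<le> 4 * \<delta>"
      using Y.equidistant_points_near[of w x y p q "real t"] p q t H by auto
    then have pq: "d p q \<le> K * (4 * \<delta>)"
      using d_le[of p q] p q mult_left_mono[of "d' p q" "4 * \<delta>" K] K_pos by linarith
    define s where "s = real t / K"
    have "s \<le> d w p" "s \<le> d w q"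
      unfolding s_def
      using d'_le[of w p] d'_le[of w q] p q H K_pos by (simp_all add: field_simps)
    moreover have "Y.gprod w x y / K - 1 / K \<le> s"
      using t K_pos unfolding s_def diff_divide_distrib[symmetric] by (intro divide_right_mono) auto
    moreover have "d w p + d p x \<le> d w x + R" "d w q + d q y \<le> d w y + R"
      using R p q H by auto
    moreover have "d x y \<le> d p x + d p q + d q y"
      using X.triangle[of x p y] X.triangle[of p q y] H p q X.commute[of x p] by linarith
    moreover have "2 * X.gprod w x y = d w x + d w y - d x y"
      by (simp add: gromov_product_def X.commute)
    moreover have "0 \<le> K * (4 * \<delta>)"
      using K_pos Y.\<delta>_pos by simp
    ultimately have "s - R - K * (4 * \<delta>) \<le> X.gprod w x y"
      using pq by linarith
    then show ?thesis
      using \<open>Y.gprod w x y / K - 1 / K \<le> s\<close> by linarith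
  qed
  then show ?thesis by blast
qed

text \<open>A point \<open>c\<close> that is \<open>d'\<close>-between \<open>x\<close> and
  \<open>y\<close> and near \<open>w\<close> is almost \<open>d\<close>-between them, and so bounds
  the product for \<open>d\<close> as well.\<close>

lemma gprod_le:
  "\<exists>B. \<forall>w\<in>M. \<forall>x\<in>M. \<forall>y\<in>M. X.gprod w x y / K - B \<le> Y.gprod w x y"
proof -
  obtain R where R: "\<And>x y c. x \<in> M \<Longrightarrow> y \<in> M \<Longrightarrow> c \<in> M \<Longrightarrow> d' x c + d' c y = d' x y \<Longrightarrow>
      d x c + d c y \<le> d x y + R"
    using hyperbolic_interval_almost_interval by blast
  have "X.gprod w x y / K - (R / 2 / K + 1 + 4 * \<delta>) \<le> Y.gprod w x y"
    if H: "w \<in> M" "x \<in> M" "y \<in> M" for w x y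
  proof -
    obtain c where c: "c \<in> M" "d' x c + d' c y = d' x y" "d' w c \<le> Y.gprod w x y + 1 + 4 * \<delta>"
      using Y.interval_point_near_base H by blast
    have "X.gprod w x y \<le> d w c + R / 2"
      using X.gprod_le_of_near R c H by blast
    also have "\<dots> \<le> K * d' w c + R / 2"
      using d_le c H by auto
    finally have "X.gprod w x y / K \<le> d' w c + R / 2 / K"
      using K_pos by (simp add: field_simps)
    then show ?thesis
      using c by linarith
  qed
  then show ?thesis by blast
qed

end

section \<open>Word metrics\<close>

locale cayley_graph = group G for G :: "('a, 'b) monoid_scheme" (structure) +
  fixes S :: "'a set"
  assumes generating: "finite_generating_set G S"
begin

abbreviation dist_S :: "'a \<Rightarrow> 'a \<Rightarrow> real" where
  "dist_S \<equiv> cayley_dist G S"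

lemma S_finite: "finite S" and S_closed: "s \<in> S \<Longrightarrow> s \<in> carrier G"
  and generate_S: "generate G S = carrier G"
  using generating by (auto simp: finite_generating_set_def)

lemma adj_closed: "(g, h) \<in> cayley_adj G S \<Longrightarrow> g \<in> carrier G \<and> h \<in> carrier G"
  by (auto simp: cayley_adj_def)

lemma adj_sym: "(g, h) \<in> cayley_adj G S \<longleftrightarrow> (h, g) \<in> cayley_adj G S"
  by (auto simp: cayley_adj_def)

lemma adj_translate:
  "a \<in> carrier G \<Longrightarrow> (g, h) \<in> cayley_adj G S \<Longrightarrow> (a \<otimes> g, a \<otimes> h) \<in> cayley_adj G S"
  using S_closed by (auto simp: cayley_adj_def m_assoc)

lemma adj_pow_closed: "(g, h) \<in> cayley_adj G S ^^ n \<Longrightarrow> g \<in> carrier G \<Longrightarrow> h \<in> carrier G"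
  using adj_closed by (cases n) auto

lemma adj_pow_sym: "(g, h) \<in> cayley_adj G S ^^ n \<longleftrightarrow> (h, g) \<in> cayley_adj G S ^^ n"
proof -
  have "(h, g) \<in> cayley_adj G S ^^ n" if "(g, h) \<in> cayley_adj G S ^^ n" for g h
    using that
  proof (induction n arbitrary: h)
    case (Suc n)
    then show ?case
      using adj_sym by (meson relpow_Suc_E relpow_Suc_I2)
  qed auto
  then show ?thesis by blast
qed

lemma adj_pow_translate:
  "a \<in> carrier G \<Longrightarrow> (g, h) \<in> cayley_adj G S ^^ n \<Longrightarrow> (a \<otimes> g, a \<otimes> h) \<in> cayley_adj G S ^^ n"
proof (induction n arbitrary: h)
  case (Suc n)
  then show ?case
    using adj_translate by (meson relpow_Suc_E relpow_Suc_I)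
qed auto

lemma connected_from_one:
  assumes "g \<in> carrier G"
  shows "\<exists>n. (\<one>, g) \<in> cayley_adj G S ^^ n"
proof -
  have "g \<in> carrier G \<and> (\<exists>n. (\<one>, g) \<in> cayley_adj G S ^^ n)" if "g \<in> generate G S"
    using that
  proof (induction rule: generate.induct)
    case one
    then show ?case by (auto intro: exI[of _ 0])
  next
    case (incl h)
    then have "(\<one>, h) \<in> cayley_adj G S ^^ 1"
      using S_closed by (auto simp: cayley_adj_def)
    then show ?case
      using incl S_closed by blast
  next
    case (inv h)
    then have "(\<one>, inv h) \<in> cayley_adj G S ^^ 1"
      using S_closed unfolding cayley_adj_def by (auto intro!: bexI[of _ h])
    then show ?case
      using inv S_closed by blast
  next
    case (eng h1 h2)
    then obtain n m where "(\<one>, h1) \<in> cayley_adj G S ^^ n" "(\<one>, h2) \<in> cayley_adj G S ^^ m"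
      by blast
    then have "(\<one>, h1 \<otimes> h2) \<in> cayley_adj G S ^^ (n + m)"
      using adj_pow_translate[of h1 \<one> h2 m] eng by (auto intro: relpow_trans)
    then show ?case
      using eng by blast
  qed
  then show ?thesis
    using assms generate_S by blast
qed

lemma connected:
  assumes "g \<in> carrier G" "h \<in> carrier G"
  shows "\<exists>n. (g, h) \<in> cayley_adj G S ^^ n"
proof -
  obtain n where "(\<one>, inv g \<otimes> h) \<in> cayley_adj G S ^^ n"
    using connected_from_one assms by blast
  then have "(g, h) \<in> cayley_adj G S ^^ n"
    using adj_pow_translate[of g \<one> "inv g \<otimes> h" n] assms by (simp add: m_assoc[symmetric])
  then show ?thesis ..
qed

lemma dist_S_le: "(g, h) \<in> cayley_adj G S ^^ n \<Longrightarrow> dist_S g h \<le> real n"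
  unfolding cayley_dist_def by (simp add: Least_le)

lemma dist_S_attained:
  assumes "g \<in> carrier G" "h \<in> carrier G"
  obtains n where "dist_S g h = real n" "(g, h) \<in> cayley_adj G S ^^ n"
  using LeastI_ex[OF connected[OF assms]] unfolding cayley_dist_def by blast

sublocale nat_geodesic_space "carrier G" dist_S
proof
  show "0 \<le> dist_S x y" for x y
    by (simp add: cayley_dist_def)
  show "dist_S x y = dist_S y x" for x y
    unfolding cayley_dist_def using adj_pow_sym by simp
  show triangle: "dist_S x z \<le> dist_S x y + dist_S y z"
    if xyz: "x \<in> carrier G" "y \<in> carrier G" "z \<in> carrier G" for x y z
  proof -
    obtain n m where "dist_S x y = real n" "(x, y) \<in> cayley_adj G S ^^ n"
        "dist_S y z = real m" "(y, z) \<in> cayley_adj G S ^^ m"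
      using dist_S_attained xyz by metis
    then show ?thesis
      using dist_S_le[OF relpow_trans[of x y n _ z m]] by simp
  qed
  show "dist_S x y = 0 \<longleftrightarrow> x = y" if xy: "x \<in> carrier G" "y \<in> carrier G" for x y
  proof
    assume "dist_S x y = 0"
    then show "x = y"
      using dist_S_attained[OF xy] by auto
  next
    assume "x = y"
    then show "dist_S x y = 0"
      using dist_S_le[of x y 0] by (simp add: cayley_dist_def)
  qed
  show "dist_S x y \<in> \<nat>" for x y
    by (simp add: cayley_dist_def)
  show "\<exists>z\<in>carrier G. dist_S x z = real n \<and> dist_S z y = dist_S x y - real n"
    if xy: "x \<in> carrier G" "y \<in> carrier G" and n: "real n \<le> dist_S x y" for x y n
  proof -
    obtain N where N: "dist_S x y = real N" "(x, y) \<in> cayley_adj G S ^^ N"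
      using dist_S_attained[OF xy] .
    \<comment> \<open>A shortest path is cut after \<open>n\<close> edges; the triangle inequality
      forces both pieces to be shortest.\<close>
    then have "(x, y) \<in> cayley_adj G S ^^ (n + (N - n))"
      using n by simp
    then obtain z where z: "(x, z) \<in> cayley_adj G S ^^ n" "(z, y) \<in> cayley_adj G S ^^ (N - n)"
      unfolding relpow_add by blast
    have "z \<in> carrier G"
      using adj_pow_closed[OF z(1)] xy by blast
    moreover have "dist_S x z \<le> n" "dist_S z y \<le> real N - n"
      using dist_S_le[OF z(1)] dist_S_le[OF z(2)] n N by (auto simp: of_nat_diff)
    ultimately show ?thesis
      using triangle[of x z y] N xy by (intro bexI[of _ z]) auto
  qed
qed

lemma dist_translate:
  assumes "a \<in> carrier G" "g \<in> carrier G" "h \<in> carrier G"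
  shows "dist_S (a \<otimes> g) (a \<otimes> h) = dist_S g h"
proof -
  have le: "dist_S (a \<otimes> g) (a \<otimes> h) \<le> dist_S g h"
    if "a \<in> carrier G" "g \<in> carrier G" "h \<in> carrier G" for a g h
    using dist_S_attained[OF that(2,3)] adj_pow_translate[OF that(1)] dist_S_le by metis
  show ?thesis
    using le[OF assms] le[of "inv a" "a \<otimes> g" "a \<otimes> h"] assms
    by (simp add: m_assoc[symmetric])
qed

lemma finite_ball: "finite {g \<in> carrier G. dist_S \<one> g \<le> r}"
proof -
  have fin: "finite {g. (\<one>, g) \<in> cayley_adj G S ^^ n}" for n
  proof (induction n)
    case (Suc n)
    have "finite {h. (g, h) \<in> cayley_adj G S}" for g
    proof (rule finite_subset)
      show "{h. (g, h) \<in> cayley_adj G S} \<subseteq> (\<lambda>s. g \<otimes> s) ` S \<union> (\<lambda>s. g \<otimes> inv s) ` S"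
      proof
        fix h assume "h \<in> {h. (g, h) \<in> cayley_adj G S}"
        then obtain s where "g \<in> carrier G" "h \<in> carrier G" "s \<in> S" "h = g \<otimes> s \<or> g = h \<otimes> s"
          by (auto simp: cayley_adj_def)
        then have "h = g \<otimes> s \<or> h = g \<otimes> inv s"
          using S_closed[of s] by (auto simp: m_assoc)
        then show "h \<in> (\<lambda>s. g \<otimes> s) ` S \<union> (\<lambda>s. g \<otimes> inv s) ` S"
          using \<open>s \<in> S\<close> by blast
      qed
    qed (use S_finite in auto)
    moreover have "{g. (\<one>, g) \<in> cayley_adj G S ^^ Suc n}
        \<subseteq> (\<Union>g\<in>{g. (\<one>, g) \<in> cayley_adj G S ^^ n}. {h. (g, h) \<in> cayley_adj G S})"
      by auto
    ultimately show ?case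
      using Suc by (meson finite_UN_I finite_subset)
  qed auto
  have "{g \<in> carrier G. dist_S \<one> g \<le> r}
      \<subseteq> (\<Union>n\<in>{..nat \<lceil>r\<rceil>}. {g. (\<one>, g) \<in> cayley_adj G S ^^ n})"
  proof clarsimp
    fix g assume g: "g \<in> carrier G" "dist_S \<one> g \<le> r"
    obtain n where "dist_S \<one> g = real n" "(\<one>, g) \<in> cayley_adj G S ^^ n"
      using dist_S_attained[OF one_closed g(1)] .
    then show "\<exists>n\<in>{..nat \<lceil>r\<rceil>}. (\<one>, g) \<in> cayley_adj G S ^^ n"
      using g by (intro bexI[of _ n]) (auto, linarith)
  qed
  then show ?thesis
    using fin by (meson finite_UN_I finite_atMost finite_subset)
qed

lemma infinite_imp_far_element:
  assumes "infinite A" "A \<subseteq> carrier G"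
  shows "\<exists>a\<in>A. r < dist_S \<one> a"
proof (rule ccontr)
  assume "\<not> (\<exists>a\<in>A. r < dist_S \<one> a)"
  then have "A \<subseteq> {g \<in> carrier G. dist_S \<one> g \<le> r}"
    using assms by force
  then show False
    using assms finite_ball finite_subset by blast
qed

lemma dist_one_inv: "a \<in> carrier G \<Longrightarrow> dist_S \<one> (inv a) = dist_S \<one> a"
  using dist_translate[of a \<one> "inv a"] commute by simp

lemma lipschitz_wrt_generators:
  assumes "finite_generating_set G T"
  shows "\<exists>K>0. \<forall>x\<in>carrier G. \<forall>y\<in>carrier G. dist_S x y \<le> K * cayley_dist G T x y"
proof -
  interpret T: cayley_graph G T
    using assms by unfold_locales
  \<comment> \<open>The largest \<open>S\<close>-length of a generator in \<open>T\<close>;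
    inserting 1 makes the set nonempty and \<open>K\<close> positive.\<close>
  define K where "K = Max (insert 1 (dist_S \<one> ` T))"
  have K: "1 \<le> K" "\<And>t. t \<in> T \<Longrightarrow> dist_S \<one> t \<le> K"
    using T.S_finite by (auto simp: K_def)
  have pow: "dist_S x y \<le> K * real n"
    if "(x, y) \<in> cayley_adj G T ^^ n" "x \<in> carrier G" for x y n
    using that
  proof (induction n arbitrary: y)
    case (Suc n)
    obtain z where z: "(x, z) \<in> cayley_adj G T ^^ n" "(z, y) \<in> cayley_adj G T"
      using Suc.prems(1) by (rule relpow_Suc_E)
    have zy: "z \<in> carrier G" "y \<in> carrier G"
      using z(2) T.adj_closed by auto
    obtain t where t: "t \<in> T" "y = z \<otimes> t \<or> z = y \<otimes> t"
      using z(2) by (auto simp: cayley_adj_def)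
    have "dist_S z y = dist_S \<one> t"
      using t zy T.S_closed[OF t(1)] dist_translate[of z \<one> t] dist_translate[of y \<one> t]
        commute[of z y] by auto
    then have "dist_S z y \<le> K"
      using K t by simp
    then show ?case
      using Suc.IH[OF z(1) Suc.prems(2)] triangle[OF Suc.prems(2) zy] by (simp add: algebra_simps)
  qed auto
  have "dist_S x y \<le> K * cayley_dist G T x y" if "x \<in> carrier G" "y \<in> carrier G" for x y
    using T.dist_S_attained[OF that] pow that by metis
  then show ?thesis
    using K by (intro exI[of _ K]) auto
qed

text \<open>Write \<open>h \<otimes> q = x \<otimes> h\<close> with \<open>x\<close> in the
  conjugate \<open>L\<close> and \<open>x = inv k \<otimes> f\<close>, where
  \<open>k \<in> P\<close> and \<open>f\<close> represents the coset of \<open>x\<close>. Then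
  \<open>inv k \<in> Q\<close> is at distance \<open>dist_S \<one> (f \<otimes> h)\<close> from
  \<open>h \<otimes> q\<close>, and finite index leaves finitely many \<open>f\<close>.\<close>

lemma commensurator_coset_near:
  assumes Q: "subgroup Q G" and h: "h \<in> commensurator G Q"
  shows "\<exists>C. \<forall>q\<in>Q. \<exists>q'\<in>Q. dist_S (h \<otimes> q) q' \<le> C"
proof -
  interpret Q: subgroup Q G by fact
  define L where "L = conjugate_subgroup G h Q"
  define P where "P = L \<inter> Q"
  let ?GL = "G\<lparr>carrier := L\<rparr>"
  have hG: "h \<in> carrier G" and P: "subgroup P ?GL" and fin: "finite (rcosets\<^bsub>?GL\<^esub> P)"
    using h by (auto simp: commensurator_def finite_index_in_def L_def P_def)
  define rep where "rep x = (SOME f. f \<in> P #>\<^bsub>?GL\<^esub> x)" for x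
  have rcosets_eq: "rcosets\<^bsub>?GL\<^esub> P = (\<lambda>x. P #>\<^bsub>?GL\<^esub> x) ` L"
    by (auto simp: RCOSETS_def)
  \<comment> \<open>\<open>rep x\<close> depends only on the coset of \<open>x\<close>, so it takes
    finitely many values.\<close>
  have "rep ` L = (\<lambda>X. SOME f. f \<in> X) ` (rcosets\<^bsub>?GL\<^esub> P)"
    by (auto simp: rcosets_eq rep_def image_image)
  then have finrep: "finite (rep ` L)"
    using fin by simp
  have LG: "L \<subseteq> carrier G"
    using hG Q.subset by (auto simp: L_def conjugate_subgroup_def)
  define C where "C = Max ((\<lambda>f. dist_S \<one> (f \<otimes> h)) ` rep ` L)"
  have "\<exists>q'\<in>Q. dist_S (h \<otimes> q) q' \<le> C" if q: "q \<in> Q" for q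
  proof -
    define x where "x = h \<otimes> q \<otimes> inv h"
    have x: "x \<in> L"
      using q by (auto simp: x_def L_def conjugate_subgroup_def)
    have "\<one> \<in> P"
      using subgroup.one_closed[OF P] by simp
    then have "\<one> \<otimes> x \<in> P #>\<^bsub>?GL\<^esub> x"
      by (auto simp: r_coset_def)
    then have "rep x \<in> P #>\<^bsub>?GL\<^esub> x"
      unfolding rep_def by (rule someI)
    then obtain k where k: "k \<in> P" "rep x = k \<otimes> x"
      by (auto simp: r_coset_def)
    have kQ: "k \<in> Q" "k \<in> carrier G"
      using k by (auto simp: P_def)
    have qG: "q \<in> carrier G"
      using q by simp
    have "x = inv k \<otimes> rep x"
      using k kQ x LG by (simp add: m_assoc[symmetric] subsetD)
    moreover have "h \<otimes> q = x \<otimes> h"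
      using hG qG by (simp add: x_def m_assoc)
    moreover have "rep x \<in> carrier G"
      using k kQ x LG by auto
    ultimately have "h \<otimes> q = inv k \<otimes> (rep x \<otimes> h)"
      using kQ hG by (metis inv_closed m_assoc)
    then have "dist_S (h \<otimes> q) (inv k) = dist_S \<one> (rep x \<otimes> h)"
      using dist_translate[of "inv k" "rep x \<otimes> h" \<one>] kQ hG \<open>rep x \<in> carrier G\<close> commute by simp
    also have "\<dots> \<le> C"
      unfolding C_def using finrep x by (intro Max_ge) auto
    finally show ?thesis
      using kQ by auto
  qed
  then show ?thesis by blast
qed

end

section \<open>Infinite subgroups of hyperbolic groups\<close>

locale hyperbolic_cayley_graph = cayley_graph +
  fixes \<delta> :: real
  assumes hyperbolic: "hyperbolic_nat_space (carrier G) dist_S \<delta>"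
begin

sublocale hyperbolic_nat_space "carrier G" dist_S \<delta>
  by (rule hyperbolic)

lemma dist_one_translate_eq:
  assumes "a \<in> carrier G" "q \<in> carrier G"
  shows "dist_S \<one> (a \<otimes> q) = dist_S \<one> a + dist_S \<one> q - 2 * gprod \<one> (inv a) q"
proof -
  have "dist_S (inv a) q = dist_S \<one> (a \<otimes> q)"
    using dist_translate[of a "inv a" q] assms by simp
  then show ?thesis
    using dist_one_inv[OF assms(1)] commute[of _ \<one>] by (simp add: gromov_product_def field_simps)
qed

text \<open>The products at \<open>\<one>\<close> and at \<open>h\<close> of a triangle with third
  vertex \<open>h \<otimes> q\<close> add up to \<open>dist_S \<one> h\<close>; translation by
  \<open>inv h\<close> moves the second one to \<open>\<one>\<close>.\<close>

lemma gprod_left_translate: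
  assumes "h \<in> carrier G" "q \<in> carrier G"
  shows "gprod \<one> h (h \<otimes> q) = dist_S \<one> h - gprod \<one> (inv h) q"
proof -
  have "dist_S h (h \<otimes> q) = dist_S \<one> q"
    using dist_translate[of h \<one> q] assms by simp
  then show ?thesis
    using dist_one_translate_eq[OF assms] commute[of _ \<one>] by (simp add: gromov_product_def field_simps)
qed

text \<open>The change of length under \<open>a\<close> is determined by the product with
  \<open>inv a\<close>. This product is at most \<open>dist_S \<one> a\<close>, hence at most
  \<open>gprod \<one> p q\<close>, so \<open>four_point\<close> makes it agree for \<open>p\<close>
  and \<open>q\<close> up to \<open>\<delta>\<close>.\<close>

lemma dist_one_translate_close:
  assumes "a \<in> carrier G" "p \<in> carrier G" "q \<in> carrier G" "dist_S \<one> a \<le> gprod \<one> p q"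
  shows "\<bar>(dist_S \<one> (a \<otimes> p) - dist_S \<one> p) - (dist_S \<one> (a \<otimes> q) - dist_S \<one> q)\<bar> \<le> 2 * \<delta>"
proof -
  have "gprod \<one> (inv a) p \<le> dist_S \<one> a" "gprod \<one> (inv a) q \<le> dist_S \<one> a"
    using gprod_le_dist[of "inv a" _ \<one>] dist_one_inv assms by auto
  moreover have "min (gprod \<one> (inv a) p) (gprod \<one> p q) - \<delta> \<le> gprod \<one> (inv a) q"
    "min (gprod \<one> (inv a) q) (gprod \<one> q p) - \<delta> \<le> gprod \<one> (inv a) p"
    using four_point assms by auto
  ultimately show ?thesis
    using dist_one_translate_eq assms gprod_commute[of \<one> q p] by auto
qed

text \<open>
  If \<open>Q\<close> accumulates at one boundary point only, then every element of \<open>Q\<close> almost preserves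
  distances from far points of \<open>Q\<close> to \<open>\<one>\<close>: otherwise the powers of some \<open>a\<close> would move away
  from \<open>\<one>\<close> in one direction and come closer to it in the other.
\<close>

lemma not_always_moved_outwards:
  assumes Q: "subgroup Q G" "infinite Q" and a: "a \<in> Q"
    and incr: "\<And>q. q \<in> Q \<Longrightarrow> N \<le> dist_S \<one> q \<Longrightarrow> dist_S \<one> q + 1 \<le> dist_S \<one> (a \<otimes> q)"
  shows False
proof -
  interpret Q: subgroup Q G by fact
  have aG: "a \<in> carrier G"
    using a by simp
  obtain q0 where q0: "q0 \<in> Q" "N < dist_S \<one> q0"
    using infinite_imp_far_element[OF Q(2) Q.subset] by blast
  have apow: "a [^] n \<in> Q" for n :: nat
    using a by (induction n) auto
  have apowG: "a [^] n \<in> carrier G" for n :: nat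
    using aG by simp
  have "a [^] n \<otimes> q0 \<in> Q \<and> dist_S \<one> q0 + real n \<le> dist_S \<one> (a [^] n \<otimes> q0)" for n :: nat
  proof (induction n)
    case (Suc n)
    have "a [^] Suc n \<otimes> q0 = a \<otimes> (a [^] n \<otimes> q0)"
      unfolding nat_pow_Suc2[OF aG] using aG q0 by (simp add: m_assoc)
    then show ?case
      using Suc incr[of "a [^] n \<otimes> q0"] q0 a by auto
  qed (use q0 in auto)
  then have far: "real n \<le> dist_S \<one> (a [^] n)" for n :: nat
    using triangle[of \<one> "a [^] n" "a [^] n \<otimes> q0"] dist_translate[of "a [^] n" \<one> q0] apowG q0
    by (smt (verit, best) Q.mem_carrier m_closed one_closed r_one)
  define n0 where "n0 = nat \<lceil>N\<rceil>"
  \<comment> \<open>By \<open>far\<close>, inverse powers beyond \<open>n0\<close> have length at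
    least \<open>N\<close>, so \<open>a\<close> moves each of them outwards to the previous one.
    Their lengths would decrease forever.\<close>
  have "dist_S \<one> (inv (a [^] (n0 + n))) + real n \<le> dist_S \<one> (inv (a [^] n0))" for n
  proof (induction n)
    case (Suc n)
    have "a \<otimes> inv (a [^] (n0 + Suc n)) = inv (a [^] (n0 + n))"
      using aG apowG by (simp add: inv_mult_group m_assoc[symmetric])
    moreover have "N \<le> dist_S \<one> (inv (a [^] (n0 + Suc n)))"
      using far[of "n0 + Suc n"] dist_one_inv[OF apowG[of "n0 + Suc n"]] unfolding n0_def by linarith
    ultimately have "dist_S \<one> (inv (a [^] (n0 + Suc n))) + 1 \<le> dist_S \<one> (inv (a [^] (n0 + n)))"
      using incr[OF Q.m_inv_closed[OF apow[of "n0 + Suc n"]]] by metis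
    then show ?case
      using Suc by linarith
  qed auto
  from this[of "nat \<lceil>dist_S \<one> (inv (a [^] n0))\<rceil> + 1"] show False
    using nonneg[of \<one> "inv (a [^] (n0 + (nat \<lceil>dist_S \<one> (inv (a [^] n0))\<rceil> + 1)))"] by linarith
qed

text \<open>
  An infinite subgroup has at least two limit points. Otherwise every \<open>a\<close> in a finite subset
  \<open>A\<close> of \<open>Q\<close> moves a point \<open>p\<close> far out on a geodesic towards the limit point by a bounded
  amount, so \<open>a \<mapsto> inv p \<otimes> a \<otimes> p\<close> injects \<open>A\<close> into a ball whose radius
  does not depend on \<open>A\<close>.
\<close>

lemma infinite_subgroup_two_ends:
  assumes Q: "subgroup Q G" "infinite Q"
  shows "\<exists>R. \<forall>N. \<exists>a\<in>Q. \<exists>b\<in>Q. N \<le> dist_S \<one> a \<and> N \<le> dist_S \<one> b \<and> gprod \<one> a b \<le> R"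
proof (rule ccontr)
  interpret Q: subgroup Q G by fact
  assume "\<not> ?thesis"
  then have one_end: "\<exists>N. \<forall>a\<in>Q. \<forall>b\<in>Q. N \<le> dist_S \<one> a \<longrightarrow> N \<le> dist_S \<one> b \<longrightarrow> R < gprod \<one> a b"
    for R by (meson not_le)
  \<comment> \<open>The change of length under \<open>a\<close> is nearly constant on far points. It
    is nonpositive at \<open>q1\<close> and nonnegative at \<open>q2\<close>, hence nearly
    zero.\<close>
  have almost: "\<exists>N. \<forall>q\<in>Q. N \<le> dist_S \<one> q \<longrightarrow> \<bar>dist_S \<one> (a \<otimes> q) - dist_S \<one> q\<bar> \<le> 2 * \<delta>"
    if a: "a \<in> Q" for a
  proof -
    obtain N where N: "\<And>q q'. q \<in> Q \<Longrightarrow> q' \<in> Q \<Longrightarrow> N \<le> dist_S \<one> q \<Longrightarrow> N \<le> dist_S \<one> q' \<Longrightarrow>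
        dist_S \<one> a < gprod \<one> q q'"
      using one_end[of "dist_S \<one> a"] by blast
    have close: "\<bar>(dist_S \<one> (a \<otimes> q) - dist_S \<one> q) - (dist_S \<one> (a \<otimes> q') - dist_S \<one> q')\<bar> \<le> 2 * \<delta>"
      if "q \<in> Q" "q' \<in> Q" "N \<le> dist_S \<one> q" "N \<le> dist_S \<one> q'" for q q'
      using dist_one_translate_close[of a q q'] N[OF that] that a by auto
    have step: "dist_S \<one> x + 1 \<le> dist_S \<one> y"
      if "x \<in> Q" "y \<in> Q" "dist_S \<one> x < dist_S \<one> y" for x y
    proof -
      have "dist_S \<one> x \<in> \<nat>" "dist_S \<one> y \<in> \<nat>"
        using dist_in_Nats that by simp_all
      then obtain m n where "dist_S \<one> x = real m" "dist_S \<one> y = real n"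
        by (elim Nats_cases)
      then show ?thesis
        using that by auto
    qed
    obtain q1 where q1: "q1 \<in> Q" "N \<le> dist_S \<one> q1" "dist_S \<one> (a \<otimes> q1) \<le> dist_S \<one> q1"
    proof (rule ccontr)
      assume "\<not> thesis"
      then show False
        using that not_always_moved_outwards[OF Q a, of N] step a by (meson Q.m_closed not_le)
    qed
    obtain q2 where q2: "q2 \<in> Q" "N \<le> dist_S \<one> q2" "dist_S \<one> q2 \<le> dist_S \<one> (a \<otimes> q2)"
    proof (rule ccontr)
      assume neg: "\<not> thesis"
      show False
      \<comment> \<open>The larger threshold keeps \<open>inv a \<otimes> q\<close> beyond
        \<open>N\<close>; since it cannot serve as \<open>q2\<close>, \<open>a\<close> shortens it
        by moving it to \<open>q\<close>.\<close>
      proof (rule not_always_moved_outwards[OF Q, of "inv a" "N + dist_S \<one> a"])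
        fix q assume q: "q \<in> Q" "N + dist_S \<one> a \<le> dist_S \<one> q"
        have "a \<otimes> (inv a \<otimes> q) = q"
          using a q by (simp add: m_assoc[symmetric])
        moreover have "N \<le> dist_S \<one> (inv a \<otimes> q)"
          using triangle[of \<one> a q] dist_translate[of "inv a" a q] a q by auto
        ultimately show "dist_S \<one> q + 1 \<le> dist_S \<one> (inv a \<otimes> q)"
          using neg that[of "inv a \<otimes> q"] step[of q "inv a \<otimes> q"] a q
          by (metis Q.m_closed Q.m_inv_closed not_le)
      qed (use a in auto)
    qed
    have "\<bar>dist_S \<one> (a \<otimes> q) - dist_S \<one> q\<bar> \<le> 2 * \<delta>" if "q \<in> Q" "N \<le> dist_S \<one> q" for q
      using close[OF that(1) q1(1) that(2) q1(2)] close[OF that(1) q2(1) that(2) q2(2)] q1 q2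
      by linarith
    then show ?thesis by blast
  qed
  \<comment> \<open>The radius comes from \<open>short\<close>:
    \<open>t + (t + 4 * \<delta>) - 2 * (t - 5 * \<delta>)\<close>.\<close>
  define B where "B = {g \<in> carrier G. dist_S \<one> g \<le> 14 * \<delta>}"
  obtain A where A: "A \<subseteq> Q" "finite A" "card A = Suc (card B)"
    using infinite_arbitrarily_large[OF Q(2)] by blast
  have AG: "\<And>a. a \<in> A \<Longrightarrow> a \<in> carrier G"
    using A by auto
  obtain t :: nat where t: "\<And>a. a \<in> A \<Longrightarrow> dist_S \<one> a \<le> real t"
  proof (rule that[of "nat \<lceil>Max (dist_S \<one> ` A)\<rceil>"])
    fix a assume "a \<in> A"
    then have "dist_S \<one> a \<le> Max (dist_S \<one> ` A)"
      using A by auto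
    then show "dist_S \<one> a \<le> real (nat \<lceil>Max (dist_S \<one> ` A)\<rceil>)"
      by linarith
  qed
  obtain NR where NR: "\<And>q q'. q \<in> Q \<Longrightarrow> q' \<in> Q \<Longrightarrow> NR \<le> dist_S \<one> q \<Longrightarrow> NR \<le> dist_S \<one> q' \<Longrightarrow>
      real t < gprod \<one> q q'"
    using one_end[of "real t"] by blast
  have "\<exists>f. \<forall>a\<in>Q. \<forall>q\<in>Q. f a \<le> dist_S \<one> q \<longrightarrow> \<bar>dist_S \<one> (a \<otimes> q) - dist_S \<one> q\<bar> \<le> 2 * \<delta>"
    using almost by metis
  then obtain f where f: "\<And>a q. a \<in> Q \<Longrightarrow> q \<in> Q \<Longrightarrow> f a \<le> dist_S \<one> q \<Longrightarrow>
      \<bar>dist_S \<one> (a \<otimes> q) - dist_S \<one> q\<bar> \<le> 2 * \<delta>"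
    by blast
  \<comment> \<open>One \<open>q\<close> serves all of \<open>A\<close>. The margin
    \<open>2 * \<delta>\<close> keeps \<open>a \<otimes> q\<close> beyond \<open>NR\<close> too, and
    \<open>t\<close> leaves room for \<open>p\<close>.\<close>
  obtain q where q: "q \<in> Q" "max (\<bar>NR\<bar> + real t + 2 * \<delta>) (Max (f ` A)) < dist_S \<one> q"
    using infinite_imp_far_element[OF Q(2) Q.subset] by blast
  have qG: "q \<in> carrier G"
    using q by simp
  obtain p where p: "p \<in> carrier G" "dist_S \<one> p = t" "dist_S p q = dist_S \<one> q - t"
    using interval_point[of \<one> q t] qG q \<delta>_pos by fastforce
  have gpq: "gprod \<one> p q = t"
    using p commute[of _ \<one>] by (simp add: gromov_product_def)
  have short: "dist_S p (a \<otimes> p) \<le> 14 * \<delta>" if a: "a \<in> A" for a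
  proof -
    have aG: "a \<in> carrier G" and aQ: "a \<in> Q"
      using a A AG by auto
    have "f a \<le> dist_S \<one> q"
      using q a A by (meson Max_ge finite_imageI imageI less_imp_le max_less_iff_conj order_trans)
    then have aq: "\<bar>dist_S \<one> (a \<otimes> q) - dist_S \<one> q\<bar> \<le> 2 * \<delta>"
      using f aQ q by blast
    have ap: "\<bar>dist_S \<one> (a \<otimes> p) - t\<bar> \<le> 4 * \<delta>"
      using dist_one_translate_close[of a p q] t[OF a] gpq p aq aG qG by auto
    \<comment> \<open>\<open>four_point\<close> is applied along the chain \<open>p\<close>,
      \<open>q\<close>, \<open>a \<otimes> q\<close>, \<open>a \<otimes> p\<close>.\<close>
    have "real t < gprod \<one> q (a \<otimes> q)"
      using q aq aQ by (intro NR) auto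
    moreover have "dist_S (a \<otimes> q) (a \<otimes> p) = dist_S \<one> q - t"
      using dist_translate[of a q p] aG qG p commute[of q p] by simp
    then have "real t - 3 * \<delta> \<le> gprod \<one> (a \<otimes> q) (a \<otimes> p)"
      using ap aq commute[of _ \<one>] by (simp add: gromov_product_def)
    moreover have "min (gprod \<one> p q) (gprod \<one> q (a \<otimes> p)) - \<delta> \<le> gprod \<one> p (a \<otimes> p)"
      "min (gprod \<one> q (a \<otimes> q)) (gprod \<one> (a \<otimes> q) (a \<otimes> p)) - \<delta> \<le> gprod \<one> q (a \<otimes> p)"
      using four_point p qG aG by auto
    ultimately have "real t - 5 * \<delta> \<le> gprod \<one> p (a \<otimes> p)"
      using gpq \<delta>_pos by linarith
    then show ?thesis
      using ap p commute[of _ \<one>] by (simp add: gromov_product_def)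
  qed
  have "inj_on (\<lambda>a. inv p \<otimes> (a \<otimes> p)) A"
    using AG p by (intro inj_onI) simp
  moreover have "(\<lambda>a. inv p \<otimes> (a \<otimes> p)) ` A \<subseteq> B"
  proof
    fix x assume "x \<in> (\<lambda>a. inv p \<otimes> (a \<otimes> p)) ` A"
    then obtain a where a: "a \<in> A" "x = inv p \<otimes> (a \<otimes> p)"
      by blast
    have "dist_S \<one> x = dist_S p (a \<otimes> p)"
      using dist_translate[of "inv p" p "a \<otimes> p"] a p AG by simp
    then show "x \<in> B"
      using short a p AG by (auto simp: B_def)
  qed
  ultimately have "card A \<le> card B"
    using finite_ball by (intro card_inj_on_le) (auto simp: B_def)
  then show False
    using A by simp
qed

text \<open>
  For \<open>h\<close> far out in the sequence, points far out in \<open>h Q\<close> stay close to \<open>Q\<close>, and since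
  \<open>Q\<close> has two limit points, one of them is not hidden behind \<open>\<one>\<close> when seen from \<open>h\<close>.
\<close>

lemma quasi_normal_accumulates:
  assumes Q: "subgroup Q G" "infinite Q" "quasi_normal G Q"
    and u: "converges_at_infinity (carrier G) dist_S \<one> u"
  shows "\<exists>q\<in>Q. \<exists>N. \<forall>i\<ge>N. r \<le> gprod \<one> (u i) q"
proof -
  interpret Q: subgroup Q G by fact
  have uG: "u i \<in> carrier G" for i
    using u by (auto simp: converges_at_infinity_def)
  obtain R where R: "\<And>N. \<exists>a\<in>Q. \<exists>b\<in>Q. N \<le> dist_S \<one> a \<and> N \<le> dist_S \<one> b \<and> gprod \<one> a b \<le> R"
    using infinite_subgroup_two_ends[OF Q(1,2)] by blast
  \<comment> \<open>One \<open>\<delta>\<close> is lost in choosing between \<open>a\<close> and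
    \<open>b\<close>, one in passing from \<open>h \<otimes> q0\<close> to \<open>q\<close>, and one
    in passing from \<open>h\<close> to \<open>u i\<close>.\<close>
  define Z where "Z = r + \<bar>R\<bar> + 3 * \<delta>"
  have "eventually (\<lambda>(i, j). Z \<le> gprod \<one> (u i) (u j)) (sequentially \<times>\<^sub>F sequentially)"
    using u by (simp add: converges_at_infinity_def filterlim_at_top case_prod_unfold)
  then obtain N where N: "\<And>i j. N \<le> i \<Longrightarrow> N \<le> j \<Longrightarrow> Z \<le> gprod \<one> (u i) (u j)"
    unfolding eventually_prod_sequentially by blast
  define h where "h = u N"
  have hG: "h \<in> carrier G"
    by (simp add: h_def uG)
  have hZ: "Z \<le> dist_S \<one> h"
    using N[of N N] gprod_le_dist[of h h \<one>] hG by (simp add: h_def)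
  have "h \<in> commensurator G Q"
    using Q(3) hG by (simp add: quasi_normal_def)
  then obtain C where C: "\<And>q. q \<in> Q \<Longrightarrow> \<exists>q'\<in>Q. dist_S (h \<otimes> q) q' \<le> C"
    using commensurator_coset_near[OF Q(1)] by blast
  \<comment> \<open>This length keeps \<open>h \<otimes> q0\<close> at distance at least
    \<open>C + Z\<close> from \<open>\<one>\<close>, so a point within \<open>C\<close> of it has
    product at least \<open>Z\<close> with it.\<close>
  obtain a b where ab: "a \<in> Q" "b \<in> Q" "dist_S \<one> h + C + Z \<le> dist_S \<one> a"
      "dist_S \<one> h + C + Z \<le> dist_S \<one> b" "gprod \<one> a b \<le> R"
    using R by blast
  have "min (gprod \<one> a (inv h)) (gprod \<one> (inv h) b) - \<delta> \<le> gprod \<one> a b"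
    using four_point ab hG by auto
  then have "gprod \<one> (inv h) a \<le> R + \<delta> \<or> gprod \<one> (inv h) b \<le> R + \<delta>"
    using ab gprod_commute[of \<one> a "inv h"] by linarith
  then obtain q0 where q0: "q0 \<in> Q" "dist_S \<one> h + C + Z \<le> dist_S \<one> q0"
      "gprod \<one> (inv h) q0 \<le> R + \<delta>"
    using ab by blast
  have q0G: "q0 \<in> carrier G"
    using q0 by simp
  obtain q where q: "q \<in> Q" "dist_S (h \<otimes> q0) q \<le> C"
    using C q0 by blast
  have qG: "q \<in> carrier G"
    using q by simp
  have "Z - R - \<delta> \<le> gprod \<one> h (h \<otimes> q0)"
    using gprod_left_translate[OF hG q0G] q0 hZ by linarith
  moreover have "Z \<le> gprod \<one> (h \<otimes> q0) q"
    using gprod_ge_dist_minus[of "h \<otimes> q0" q \<one>] q q0 qG q0G hG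
      triangle[of \<one> "inv h" q0] dist_translate[of h "inv h" q0] dist_one_inv[of h] by auto
  moreover have "min (gprod \<one> h (h \<otimes> q0)) (gprod \<one> (h \<otimes> q0) q) - \<delta> \<le> gprod \<one> h q"
    using four_point hG qG q0G by auto
  ultimately have hq: "r + \<delta> \<le> gprod \<one> h q"
    using \<delta>_pos unfolding Z_def by linarith
  have "r \<le> gprod \<one> (u i) q" if "N \<le> i" for i
  proof -
    have "Z \<le> gprod \<one> (u i) h"
      using N[of i N] that by (simp add: h_def)
    moreover have "min (gprod \<one> (u i) h) (gprod \<one> h q) - \<delta> \<le> gprod \<one> (u i) q"
      using four_point hG qG uG by auto
    ultimately show ?thesis
      using hq \<delta>_pos unfolding Z_def by linarith
  qed
  then show ?thesis
    using q by blast
qed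

end

section \<open>Limit sets\<close>

text \<open>Needed because the topology is given by its open sets: a point is known to lie in
  \<open>topspace\<close> only through an open set containing it.\<close>

lemma openin_bordification_space:
  "openin (bordification M d b) (Inl ` M \<union> Inr ` gromov_boundary M d b)"
  unfolding openin_bordification bordification_open_def boundary_nhd_def
  by (auto intro: exI[of _ 1])

text \<open>A basic neighbourhood accepts any representing sequence, so one \<open>u\<close>
  suffices; points tagged \<open>Inl\<close> differ from \<open>Inr \<xi>\<close>
  automatically.\<close>

lemma in_derived_set_of_boundary:
  assumes \<xi>: "\<xi> \<in> gromov_boundary M d b" and "A \<subseteq> M"
    and near: "\<And>u r. u \<in> \<xi> \<Longrightarrow> converges_at_infinity M d b u \<Longrightarrow>
      \<exists>q\<in>A. \<exists>N. \<forall>i\<ge>N. r \<le> gromov_product d b (u i) q"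
  shows "Inr \<xi> \<in> bordification M d b derived_set_of (Inl ` A)"
  unfolding in_derived_set_of
proof (intro conjI allI impI)
  show "Inr \<xi> \<in> topspace (bordification M d b)"
    by (rule subsetD[OF openin_subset[OF openin_bordification_space]]) (simp add: \<xi>)
next
  fix T assume T: "Inr \<xi> \<in> T \<and> openin (bordification M d b) T"
  then obtain r where r: "boundary_nhd M d b \<xi> r \<subseteq> T"
    by (auto simp: openin_bordification bordification_open_def)
  obtain u where u: "converges_at_infinity M d b u" "\<xi> = boundary_rel M d b `` {u}"
    using \<xi> by (auto simp: gromov_boundary_def quotient_def)
  then have "u \<in> \<xi>"
    by (auto simp: boundary_rel_def converges_at_infinity_def)
  then obtain q N where q: "q \<in> A" "\<And>i. N \<le> i \<Longrightarrow> r \<le> gromov_product d b (u i) q"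
    using near u(1) by blast
  have "ereal r \<le> liminf (\<lambda>i. ereal (gromov_product d b (u i) q))"
    using q(2) by (intro Liminf_bounded) (auto simp: eventually_sequentially)
  then have "Inl q \<in> boundary_nhd M d b \<xi> r"
    using q \<open>A \<subseteq> M\<close> \<open>u \<in> \<xi>\<close> unfolding boundary_nhd_def by blast
  then show "\<exists>y. y \<noteq> Inr \<xi> \<and> y \<in> Inl ` A \<and> y \<in> T"
    using q r by blast
qed

lemma word_hyperbolicE:
  assumes "word_hyperbolic G"
  obtains S \<delta> where "hyperbolic_cayley_graph G S \<delta>"
proof -
  obtain S \<delta> where S: "group G" "finite_generating_set G S" and
    \<delta>: "\<And>x y z w. x \<in> carrier G \<Longrightarrow> y \<in> carrier G \<Longrightarrow> z \<in> carrier G \<Longrightarrow> w \<in> carrier G \<Longrightarrow>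
      min (gromov_product (cayley_dist G S) w x y) (gromov_product (cayley_dist G S) w y z) - \<delta>
        \<le> gromov_product (cayley_dist G S) w x z"
    using assms unfolding word_hyperbolic_def gromov_hyperbolic_def by metis
  interpret cayley_graph G S
    using S by (simp add: cayley_graph_def cayley_graph_axioms_def)
  \<comment> \<open>The maximum makes the constant positive.\<close>
  have "hyperbolic_cayley_graph G S (max \<delta> 1)"
  proof (intro hyperbolic_cayley_graph.intro hyperbolic_cayley_graph_axioms.intro
      hyperbolic_nat_space.intro hyperbolic_nat_space_axioms.intro)
    fix x y z w
    assume "x \<in> carrier G" "y \<in> carrier G" "z \<in> carrier G" "w \<in> carrier G"
    then show "min (gprod w x y) (gprod w y z) - max \<delta> 1 \<le> gprod w x z"
      using \<delta>[of x y z w] by linarith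
  qed (unfold_locales, simp)
  then show thesis
    by (rule that)
qed

lemma bilipschitz_cayley_graphs:
  assumes "cayley_graph G S" "hyperbolic_cayley_graph G T \<delta>"
  obtains K where "bilipschitz_metrics (carrier G) (cayley_dist G S) (cayley_dist G T) \<delta> K"
proof -
  interpret S: cayley_graph G S by fact
  interpret T: hyperbolic_cayley_graph G T \<delta> by fact
  obtain K1 where K1: "K1 > 0" "\<And>x y. x \<in> carrier G \<Longrightarrow> y \<in> carrier G \<Longrightarrow>
      cayley_dist G S x y \<le> K1 * cayley_dist G T x y"
    using S.lipschitz_wrt_generators[OF T.generating] by blast
  obtain K2 where K2: "K2 > 0" "\<And>x y. x \<in> carrier G \<Longrightarrow> y \<in> carrier G \<Longrightarrow>
      cayley_dist G T x y \<le> K2 * cayley_dist G S x y"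
    using T.lipschitz_wrt_generators[OF S.generating] by blast
  have "bilipschitz_metrics (carrier G) (cayley_dist G S) (cayley_dist G T) \<delta> (max K1 K2)"
  proof unfold_locales
    show "0 < max K1 K2"
      using K1 by simp
    fix x y assume xy: "x \<in> carrier G" "y \<in> carrier G"
    show "cayley_dist G S x y \<le> max K1 K2 * cayley_dist G T x y"
      using K1(2)[OF xy] mult_right_mono[of K1 "max K1 K2" "cayley_dist G T x y"] by force
    show "cayley_dist G T x y \<le> max K1 K2 * cayley_dist G S x y"
      using K2(2)[OF xy] mult_right_mono[of K2 "max K1 K2" "cayley_dist G S x y"] by force
  qed
  then show thesis
    by (rule that)
qed

theorem theorem17:
  fixes H :: "('a, 'b) monoid_scheme" and Q S :: "'a set"
  assumes "word_hyperbolic H"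
    and "subgroup Q H"
    and "infinite Q"
    and "quasi_normal H Q"
    and "finite_generating_set H S"
  shows "limit_set H S Q = group_boundary H S"
proof -
  obtain T \<delta> where T: "hyperbolic_cayley_graph H T \<delta>"
    using word_hyperbolicE[OF assms(1)] .
  interpret T: hyperbolic_cayley_graph H T \<delta> by fact
  interpret S: cayley_graph H S
    using assms(5) by unfold_locales
  obtain K where "bilipschitz_metrics (carrier H) (cayley_dist H S) (cayley_dist H T) \<delta> K"
    using bilipschitz_cayley_graphs[OF S.cayley_graph_axioms T] .
  then interpret K: bilipschitz_metrics "carrier H" "cayley_dist H S" "cayley_dist H T" \<delta> K .
  obtain B where B: "\<And>w x y. w \<in> carrier H \<Longrightarrow> x \<in> carrier H \<Longrightarrow> y \<in> carrier H \<Longrightarrow>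
      T.gprod w x y / K - B \<le> S.gprod w x y"
    using K.gprod_ge by blast
  obtain B' where B': "\<And>w x y. w \<in> carrier H \<Longrightarrow> x \<in> carrier H \<Longrightarrow> y \<in> carrier H \<Longrightarrow>
      S.gprod w x y / K - B' \<le> T.gprod w x y"
    using K.gprod_le by blast
  have QH: "Q \<subseteq> carrier H"
    using assms(2) subgroup.subset by blast
  \<comment> \<open>Convergence passes from \<open>S\<close> to \<open>T\<close> by
    \<open>B'\<close>, accumulation is obtained for the hyperbolic metric of \<open>T\<close>, and
    \<open>B\<close> brings it back to \<open>S\<close>. The bounds \<open>(Z + B') * K\<close> and
    \<open>(r + B) * K\<close> invert the affine comparisons.\<close>
  have near: "\<exists>q\<in>Q. \<exists>N. \<forall>i\<ge>N. r \<le> S.gprod \<one>\<^bsub>H\<^esub> (u i) q"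
    if u: "converges_at_infinity (carrier H) (cayley_dist H S) \<one>\<^bsub>H\<^esub> u" for u r
  proof -
    have uH: "u i \<in> carrier H" for i
      using u by (auto simp: converges_at_infinity_def)
    have "filterlim (\<lambda>(i, j). T.gprod \<one>\<^bsub>H\<^esub> (u i) (u j)) at_top (sequentially \<times>\<^sub>F sequentially)"
      unfolding filterlim_at_top
    proof
      fix Z
      have "eventually (\<lambda>(i, j). (Z + B') * K \<le> S.gprod \<one>\<^bsub>H\<^esub> (u i) (u j))
          (sequentially \<times>\<^sub>F sequentially)"
        using u by (simp add: converges_at_infinity_def filterlim_at_top case_prod_unfold)
      then show "eventually (\<lambda>x. Z \<le> (case x of (i, j) \<Rightarrow> T.gprod \<one>\<^bsub>H\<^esub> (u i) (u j)))
          (sequentially \<times>\<^sub>F sequentially)"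
      proof (rule eventually_mono)
        fix x assume x: "case x of (i, j) \<Rightarrow> (Z + B') * K \<le> S.gprod \<one>\<^bsub>H\<^esub> (u i) (u j)"
        obtain i j where ij: "x = (i, j)" by force
        then have "Z + B' \<le> S.gprod \<one>\<^bsub>H\<^esub> (u i) (u j) / K"
          using x K.K_pos by (simp add: pos_le_divide_eq)
        then show "Z \<le> (case x of (i, j) \<Rightarrow> T.gprod \<one>\<^bsub>H\<^esub> (u i) (u j))"
          using B'[of "\<one>\<^bsub>H\<^esub>" "u i" "u j"] uH ij by auto
      qed
    qed
    then have "converges_at_infinity (carrier H) (cayley_dist H T) \<one>\<^bsub>H\<^esub> u"
      using uH by (auto simp: converges_at_infinity_def)
    then obtain q N where q: "q \<in> Q" "\<And>i. N \<le> i \<Longrightarrow> (r + B) * K \<le> T.gprod \<one>\<^bsub>H\<^esub> (u i) q"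
      using T.quasi_normal_accumulates[OF assms(2,3,4)] by blast
    have "r \<le> S.gprod \<one>\<^bsub>H\<^esub> (u i) q" if "N \<le> i" for i
    proof -
      have "r + B \<le> T.gprod \<one>\<^bsub>H\<^esub> (u i) q / K"
        using q(2)[OF that] K.K_pos by (simp add: pos_le_divide_eq)
      then show ?thesis
        using B[of "\<one>\<^bsub>H\<^esub>" "u i" q] uH q(1) QH by force
    qed
    then show ?thesis
      using q(1) by blast
  qed
  show ?thesis
    unfolding limit_set_def group_boundary_def
    using in_derived_set_of_boundary[OF _ QH near] by blast
qed

end
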